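(* Let $\mathcal{H}$ be a complex separable Hilbert space and let $\mathcal{M},\mathcal{N}$ be subspaces of $\mathcal{H}$ such that $P_{\mathcal{M},\mathcal{N}}$ is a closed multivalued projection (equivalently, $\mathcal{M}$ and $\mathcal{N}$ are closed). Then, as linear relations on $\mathcal{H}$, $$P_{\mathcal{M},\mathcal{N}}=(I-P_{\mathcal{N}}P_{\mathcal{M}})^{-1}P_{\mathcal{N}^{\perp}}|_{\mathcal{M}+\mathcal{N}}.$$
   Context: A linear relation on $\mathcal{H}$ is a linear subspace of $\mathcal{H}\times\mathcal{H}$; operators are identified with their graphs. $T^{-1}=\{(y,x):(x,y)\in T\}$ (a relation, even if $T$ is a non-injective operator) and $RT=\{(x,y):(x,z)\in T,(z,y)\in R\text{ for some }z\}$. For subspaces $\mathcal{M},\mathcal{N}$ of $\mathcal{H}$, $P_{\mathcal{M},\mathcal{N}}=\{(m+n,m):m\in\mathcal{M},n\in\mathcal{N}\}$. For a closed subspace $\mathcal{S}$, $P_{\mathcal{S}}$ is the orthogonal projection onto $\mathcal{S}$; $|_{\mathcal{M}+\mathcal{N}}$ denotes restriction to the domain $\mathcal{M}+\mathcal{N}$. *)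

theory Defs
  imports "HOL-Analysis.Analysis"
begin

section \<open>Complex Hilbert spaces\<close>

class complex_vector = real_vector +
  fixes scaleC :: "complex \<Rightarrow> 'a \<Rightarrow> 'a"  (infixr \<open>*\<^sub>C\<close> 75)
  assumes scaleC_add_right: "a *\<^sub>C (x + y) = a *\<^sub>C x + a *\<^sub>C y"
    and scaleC_add_left: "(a + b) *\<^sub>C x = a *\<^sub>C x + b *\<^sub>C x"
    and scaleC_scaleC: "a *\<^sub>C b *\<^sub>C x = (a * b) *\<^sub>C x"
    and scaleC_one: "1 *\<^sub>C x = x"
    and scaleR_scaleC: "r *\<^sub>R x = complex_of_real r *\<^sub>C x"

lemma vector_space_scaleC: "vector_space (scaleC :: complex \<Rightarrow> 'a::complex_vector \<Rightarrow> 'a)"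
  by unfold_locales
    (simp_all add: scaleC_add_right scaleC_add_left scaleC_scaleC scaleC_one)

global_interpretation complex_vector:
  vector_space "scaleC :: complex \<Rightarrow> 'a::complex_vector \<Rightarrow> 'a"
  defines csubspace = complex_vector.subspace
  by (rule vector_space_scaleC)

instantiation prod :: (complex_vector, complex_vector) complex_vector
begin

definition scaleC_prod_def: "c *\<^sub>C z = (c *\<^sub>C fst z, c *\<^sub>C snd z)"

instance
  by standard
    (simp_all add: scaleC_prod_def prod_eq_iff scaleC_add_right scaleC_add_left
      scaleC_scaleC scaleC_one scaleR_scaleC)

end

text \<open>
  The complex inner product is linear in its first argument, and its real part is the real inner
  product of the underlying real space. Positive definiteness, the norm and the topology are
  therefore the ones of \<^class>\<open>real_inner\<close>.
\<close>

class complex_inner = complex_vector + real_inner +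
  fixes cinner :: "'a \<Rightarrow> 'a \<Rightarrow> complex"
  assumes cinner_commute: "cinner x y = cnj (cinner y x)"
    and cinner_add_left: "cinner (x + y) z = cinner x z + cinner y z"
    and cinner_scaleC_left: "cinner (c *\<^sub>C x) y = c * cinner x y"
    and Re_cinner: "Re (cinner x y) = inner x y"

class chilbert_space = complex_inner + complete_space

instantiation complex :: chilbert_space
begin

definition scaleC_complex_def: "c *\<^sub>C (z::complex) = c * z"

definition cinner_complex_def: "cinner x (y::complex) = x * cnj y"

instance
  by standard
    (simp_all add: scaleC_complex_def cinner_complex_def algebra_simps scaleR_conv_of_real
      inner_complex_def)

end

definition orth_compl :: "'a::complex_inner set \<Rightarrow> 'a set"
  where "orth_compl S = {x. \<forall>s\<in>S. cinner x s = 0}"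

text \<open>Meaningful when \<open>S\<close> is a closed subspace of a Hilbert space.\<close>

definition orth_proj :: "'a::complex_inner set \<Rightarrow> 'a \<Rightarrow> 'a"
  where "orth_proj S x = (THE s. s \<in> S \<and> x - s \<in> orth_compl S)"


section \<open>Linear relations\<close>

abbreviation linear_relation :: "('a::complex_vector \<times> 'a) set \<Rightarrow> bool"
  where "linear_relation T \<equiv> csubspace T"

definition graph :: "('a \<Rightarrow> 'a) \<Rightarrow> ('a \<times> 'a) set"
  where "graph f = {(x, f x) | x. True}"

text \<open>
  The product \<open>R T\<close> of linear relations applies \<open>T\<close> first, whereas \<^term>\<open>T O R\<close> is read from left
  to right. The inverse of a linear relation is \<^term>\<open>converse T\<close>.
\<close>

definition rel_prod :: "('a \<times> 'a) set \<Rightarrow> ('a \<times> 'a) set \<Rightarrow> ('a \<times> 'a) set"  (infixr \<open>\<odot>\<close> 70)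
  where "R \<odot> T = T O R"

definition rel_restrict :: "('a \<times> 'a) set \<Rightarrow> 'a set \<Rightarrow> ('a \<times> 'a) set"
  where "rel_restrict T D = {(x, y). (x, y) \<in> T \<and> x \<in> D}"

definition multivalued_projection :: "('a::complex_vector \<times> 'a) set \<Rightarrow> bool"
  where "multivalued_projection E \<longleftrightarrow>
    linear_relation E \<and> E \<odot> E = E \<and> Range E \<subseteq> Domain E"

definition proj_rel :: "'a::complex_vector set \<Rightarrow> 'a set \<Rightarrow> ('a \<times> 'a) set"
  where "proj_rel M N = {(m + n, m) | m n. m \<in> M \<and> n \<in> N}"

end

(* If (m + n, y) lies in the relation on the right, then d = y - m satisfies d = P_N (P_M d). Since
   orthogonal projections shorten every vector that they move, d belongs to M and N, and
   m + n = y + (n - d) is a decomposition that exhibits (m + n, y) as an element of P_{M,N}. *)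
theory Submission
  imports Defs
begin

lemma cinner_scaleC_right: "cinner x (c *\<^sub>C y) = cnj c * cinner x y"
  for x :: "'a::complex_inner"
  by (metis cinner_commute cinner_scaleC_left complex_cnj_mult)

lemma csubspace_imp_subspace: "subspace S" if "csubspace S"
  for S :: "'a::complex_vector set"
  using that by (simp add: subspace_def complex_vector.subspace_def scaleR_scaleC)

text \<open>Bridges complex and real orthogonality: the class axioms tie only the real part of
  \<open>cinner\<close> to \<open>inner\<close>, but closure under multiplication by \<i> recovers
  the imaginary part. Nearest-point arguments can then run in the underlying real space.\<close>

lemma orth_compl_iff_inner:
  fixes S :: "'a::complex_inner set"
  assumes "csubspace S"
  shows "x \<in> orth_compl S \<longleftrightarrow> (\<forall>s\<in>S. inner x s = 0)"
proof
  assume "x \<in> orth_compl S"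
  then show "\<forall>s\<in>S. inner x s = 0"
    by (metis (mono_tags, lifting) Re_cinner mem_Collect_eq orth_compl_def zero_complex.sel(1))
next
  assume orth: "\<forall>s\<in>S. inner x s = 0"
  have "cinner x s = 0" if "s \<in> S" for s
  proof (rule complex_eqI)
    show "Re (cinner x s) = Re 0"
      using orth that by (simp add: Re_cinner)
    \<comment> \<open>Conjugate linearity in the second argument gives
      \<open>cinner x (\<i> *\<^sub>C s) = - \<i> * cinner x s\<close>, whose real part is the
      imaginary part of \<open>cinner x s\<close>.\<close>
    have "\<i> *\<^sub>C s \<in> S"
      using assms that by (rule complex_vector.subspace_scale)
    then have "Re (cinner x (\<i> *\<^sub>C s)) = 0"
      using orth by (simp add: Re_cinner)
    then show "Im (cinner x s) = Im 0"
      by (simp add: cinner_scaleC_right)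
  qed
  then show "x \<in> orth_compl S"
    by (simp add: orth_compl_def)
qed

lemma csubspace_orth_compl: "csubspace (orth_compl S)"
  for S :: "'a::complex_inner set"
proof -
  have "cinner 0 s = 0" for s :: 'a
    using cinner_add_left[of 0 0 s] by simp
  then show ?thesis
    by (simp add: complex_vector.subspace_def orth_compl_def cinner_add_left cinner_scaleC_left)
qed

text \<open>A minimizing sequence for the squared distance is Cauchy by the parallelogram law;
  completeness supplies its limit and closedness keeps the limit in \<open>S\<close>.\<close>

lemma subspace_nearest_point_exists:
  fixes S :: "'a::{real_inner, complete_space} set"
  assumes sub: "subspace S" and "closed S"
  obtains p where "p \<in> S" and "\<And>s. s \<in> S \<Longrightarrow> norm (x - p) \<le> norm (x - s)"
proof -
  define D where "D = (INF s\<in>S. (norm (x - s))\<^sup>2)"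
  have bdd: "bdd_below ((\<lambda>s. (norm (x - s))\<^sup>2) ` S)"
    by (rule bdd_belowI[of _ 0]) auto
  have ne: "S \<noteq> {}"
    using subspace_0[OF sub] by auto
  have D_le: "D \<le> (norm (x - s))\<^sup>2" if "s \<in> S" for s
    unfolding D_def by (rule cINF_lower[OF bdd that])
  have "\<exists>s\<in>S. (norm (x - s))\<^sup>2 < D + inverse (real (Suc k))" for k
    using cINF_less_iff[OF ne bdd, of "D + inverse (real (Suc k))"] unfolding D_def by simp
  then obtain s where s: "\<And>k. s k \<in> S"
    and near: "\<And>k. (norm (x - s k))\<^sup>2 < D + inverse (real (Suc k))"
    by metis
  have gap: "(norm (s j - s k))\<^sup>2 < 2 * inverse (real (Suc j)) + 2 * inverse (real (Suc k))" for j k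
  proof -
    \<comment> \<open>The parallelogram law for \<open>x - s j\<close> and \<open>x - s k\<close>
      involves the distance from \<open>x\<close> to their midpoint. The midpoint lies in
      \<open>S\<close>, so that squared distance is at least \<open>D\<close>, and the
      \<open>4 * D\<close> it removes cancels the two copies of \<open>2 * D\<close> coming from
      \<open>near\<close>.\<close>
    have mid: "(1/2) *\<^sub>R (s j + s k) \<in> S"
      by (intro subspace_scale subspace_add sub s)
    have "(norm (s j - s k))\<^sup>2 =
        2 * (norm (x - s j))\<^sup>2 + 2 * (norm (x - s k))\<^sup>2 - 4 * (norm (x - (1/2) *\<^sub>R (s j + s k)))\<^sup>2"
      by (simp add: power2_norm_eq_inner algebra_simps inner_commute)
    then show ?thesis
      using D_le[OF mid] near[of j] near[of k] by simp
  qed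
  have "Cauchy s"
  proof (rule CauchyI)
    fix e :: real
    assume "e > 0"
    \<comment> \<open>The factor 4 matches \<open>gap\<close>, whose bound is at most
      \<open>4 * inverse (real (Suc K))\<close> for indices from \<open>K\<close> on.\<close>
    then obtain K where K: "inverse (real (Suc K)) < e\<^sup>2 / 4"
      using reals_Archimedean[of "e\<^sup>2 / 4"] by auto
    have "norm (s j - s k) < e" if "j \<ge> K" "k \<ge> K" for j k
    proof (rule power2_less_imp_less)
      have "inverse (real (Suc j)) \<le> inverse (real (Suc K))"
        and "inverse (real (Suc k)) \<le> inverse (real (Suc K))"
        using that by (auto intro!: le_imp_inverse_le)
      then show "(norm (s j - s k))\<^sup>2 < e\<^sup>2"
        using gap[of j k] K by linarith
    qed (use \<open>e > 0\<close> in simp)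
    then show "\<exists>K. \<forall>j\<ge>K. \<forall>k\<ge>K. norm (s j - s k) < e"
      by blast
  qed
  then obtain p where lim: "s \<longlonglongrightarrow> p"
    using Cauchy_convergent convergent_def by blast
  have "p \<in> S"
    using closed_sequentially[OF \<open>closed S\<close>] s lim by blast
  have "(\<lambda>k. D + inverse (real (Suc k))) \<longlonglongrightarrow> D + 0"
    by (intro tendsto_intros LIMSEQ_inverse_real_of_nat)
  moreover have "(\<lambda>k. (norm (x - s k))\<^sup>2) \<longlonglongrightarrow> (norm (x - p))\<^sup>2"
    by (intro tendsto_intros lim)
  ultimately have "(norm (x - p))\<^sup>2 \<le> D"
    using LIMSEQ_le near by (metis (no_types, lifting) add.right_neutral less_imp_le)
  then have "norm (x - p) \<le> norm (x - t)" if "t \<in> S" for t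
    using D_le[OF that] by (meson norm_ge_zero order_trans power2_le_imp_le)
  with \<open>p \<in> S\<close> show ?thesis
    using that by blast
qed

text \<open>If the residual had a component along \<open>s\<close>, shifting \<open>p\<close> by
  that component would stay in \<open>S\<close> and lower the squared distance by
  \<open>(inner (x - p) s)\<^sup>2 / inner s s\<close>.\<close>

lemma inner_eq_0_if_nearest:
  fixes S :: "'a::real_inner set"
  assumes sub: "subspace S" and "p \<in> S" and "s \<in> S"
    and nearest: "\<And>t. t \<in> S \<Longrightarrow> norm (x - p) \<le> norm (x - t)"
  shows "inner (x - p) s = 0"
proof (cases "s = 0")
  case False
  \<comment> \<open>This coefficient minimizes the norm of \<open>(x - p) - c *\<^sub>R s\<close>
    over all real multiples of \<open>s\<close>.\<close>
  define c where "c = inner (x - p) s / inner s s"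
  have "p + c *\<^sub>R s \<in> S"
    by (intro subspace_add subspace_scale sub assms)
  then have "(norm (x - p))\<^sup>2 \<le> (norm (x - (p + c *\<^sub>R s)))\<^sup>2"
    by (intro power_mono nearest) auto
  also have "\<dots> = (norm ((x - p) - c *\<^sub>R s))\<^sup>2"
    by (simp add: algebra_simps)
  also have "\<dots> = (norm (x - p))\<^sup>2 - 2 * (c * inner (x - p) s) + c * (c * inner s s)"
    unfolding power2_norm_eq_inner
    by (simp add: inner_diff_left inner_diff_right inner_commute)
  also have "c * inner s s = inner (x - p) s"
    using False by (simp add: c_def)
  finally have "c * inner (x - p) s \<le> 0"
    by simp
  then have "(inner (x - p) s)\<^sup>2 / inner s s \<le> 0"
    by (simp add: c_def power2_eq_square)
  then show ?thesis
    using False by (simp add: divide_le_0_iff flip: power2_norm_eq_inner)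
qed simp

text \<open>Two candidates differ by a vector lying both in \<open>S\<close> and in its complement,
  hence orthogonal to itself. This uniqueness is what evaluates the definite description in
  \<open>orth_proj\<close>.\<close>

lemma orth_proj_eqI:
  fixes S :: "'a::complex_inner set"
  assumes sub: "csubspace S" and p: "p \<in> S" "x - p \<in> orth_compl S"
  shows "orth_proj S x = p"
  unfolding orth_proj_def
proof (rule the_equality)
  fix q
  assume q: "q \<in> S \<and> x - q \<in> orth_compl S"
  have "(x - p) - (x - q) \<in> orth_compl S"
    using p q by (blast intro: complex_vector.subspace_diff csubspace_orth_compl)
  moreover have "q - p \<in> S"
    using p q sub by (intro complex_vector.subspace_diff) auto
  ultimately have "inner (q - p) (q - p) = 0"
    using sub by (simp add: orth_compl_iff_inner)
  then show "q = p"
    by simp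
qed (use p in simp)

text \<open>The existence half: the nearest point of \<open>S\<close> has a residual orthogonal to
  \<open>S\<close>, so by uniqueness it is the value of \<open>orth_proj\<close>.\<close>

lemma
  fixes S :: "'a::chilbert_space set"
  assumes sub: "csubspace S" and "closed S"
  shows orth_proj_mem: "orth_proj S x \<in> S"
    and orth_proj_residual: "x - orth_proj S x \<in> orth_compl S"
proof -
  obtain p where "p \<in> S" and "\<And>s. s \<in> S \<Longrightarrow> norm (x - p) \<le> norm (x - s)"
    using subspace_nearest_point_exists[OF csubspace_imp_subspace[OF sub] \<open>closed S\<close>, of x] by blast
  then have "x - p \<in> orth_compl S"
    using inner_eq_0_if_nearest[OF csubspace_imp_subspace[OF sub]] sub
    by (simp add: orth_compl_iff_inner)
  with \<open>p \<in> S\<close> have "orth_proj S x = p"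
    using sub by (intro orth_proj_eqI)
  with \<open>p \<in> S\<close> \<open>x - p \<in> orth_compl S\<close>
  show "orth_proj S x \<in> S" "x - orth_proj S x \<in> orth_compl S"
    by simp_all
qed

lemma orth_proj_ident: "orth_proj S x = x" if "csubspace S" "x \<in> S"
  for S :: "'a::complex_inner set"
  using that by (simp add: orth_proj_eqI complex_vector.subspace_0[OF csubspace_orth_compl])

lemma orth_proj_diff:
  fixes S :: "'a::chilbert_space set"
  assumes "csubspace S" "closed S"
  shows "orth_proj S (x - y) = orth_proj S x - orth_proj S y"
proof (rule orth_proj_eqI)
  show "orth_proj S x - orth_proj S y \<in> S"
    using assms by (intro complex_vector.subspace_diff orth_proj_mem)
  have "(x - orth_proj S x) - (y - orth_proj S y) \<in> orth_compl S"
    using assms by (intro complex_vector.subspace_diff csubspace_orth_compl orth_proj_residual)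
  then show "x - y - (orth_proj S x - orth_proj S y) \<in> orth_compl S"
    by (simp add: algebra_simps)
qed (rule assms)

text \<open>The two summands of \<open>x\<close> swap roles, since every vector of \<open>S\<close>
  is orthogonal to \<open>orth_compl S\<close>.\<close>

lemma orth_proj_orth_compl:
  fixes S :: "'a::chilbert_space set"
  assumes "csubspace S" "closed S"
  shows "orth_proj (orth_compl S) x = x - orth_proj S x"
proof (rule orth_proj_eqI)
  have "cinner (orth_proj S x) t = 0" if "t \<in> orth_compl S" for t
    using that orth_proj_mem[OF assms] cinner_commute[of "orth_proj S x" t]
    by (simp add: orth_compl_def)
  then show "x - (x - orth_proj S x) \<in> orth_compl (orth_compl S)"
    by (simp add: orth_compl_def)
qed (use assms in \<open>auto intro: csubspace_orth_compl orth_proj_residual\<close>)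

lemma norm_orth_proj_pythagoras:
  fixes S :: "'a::chilbert_space set"
  assumes "csubspace S" "closed S"
  shows "(norm x)\<^sup>2 = (norm (orth_proj S x))\<^sup>2 + (norm (x - orth_proj S x))\<^sup>2"
proof -
  have "inner (x - orth_proj S x) (orth_proj S x) = 0"
    using orth_proj_mem[OF assms] orth_proj_residual[OF assms] assms(1)
    by (simp add: orth_compl_iff_inner)
  then show ?thesis
    by (simp add: power2_norm_eq_inner algebra_simps inner_commute)
qed

lemma orth_proj_comp_fixed_point:
  fixes M N :: "'a::chilbert_space set"
  assumes M: "csubspace M" "closed M" and N: "csubspace N" "closed N"
    and fixed: "orth_proj N (orth_proj M x) = x"
  shows "x \<in> M \<inter> N"
proof
  \<comment> \<open>Pythagoras for \<open>M\<close> at \<open>x\<close> and for \<open>N\<close> at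
    \<open>orth_proj M x\<close> are added. As the second projection returns to \<open>x\<close>,
    the squared norms of \<open>x\<close> and \<open>orth_proj M x\<close> cancel and only the two
    residuals remain.\<close>
  have "(norm (x - orth_proj M x))\<^sup>2 + (norm (orth_proj M x - x))\<^sup>2 = 0"
    using norm_orth_proj_pythagoras[OF M, of x] norm_orth_proj_pythagoras[OF N, of "orth_proj M x"]
    by (simp add: fixed)
  then have "x = orth_proj M x"
    by (simp add: norm_minus_commute)
  then show "x \<in> M"
    using orth_proj_mem[OF M, of x] by simp
  show "x \<in> N"
    using orth_proj_mem[OF N, of "orth_proj M x"] by (simp add: fixed)
qed

text \<open>\<open>M\<close> is the set of fixed points of the relation and \<open>N\<close> its
  kernel. Each is the preimage of \<open>proj_rel M N\<close> under a continuous map,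
  \<open>x\<close> to \<open>(x, x)\<close> or \<open>x\<close> to \<open>(x, 0)\<close>, so
  closedness of the relation passes to both.\<close>

lemma
  fixes M N :: "'a::{complex_vector, real_normed_vector} set"
  assumes "csubspace M" "csubspace N" and P: "closed (proj_rel M N)"
  shows closed_range_if_closed_proj_rel: "closed M"
    and closed_kernel_if_closed_proj_rel: "closed N"
proof -
  have "M = (\<lambda>x. (x, x)) -` proj_rel M N"
    using complex_vector.subspace_0[OF assms(2)] by (auto simp: proj_rel_def)
  then show "closed M"
    using continuous_closed_vimage[OF P, of "\<lambda>x. (x, x)"] by simp
  have "N = (\<lambda>x. (x, 0)) -` proj_rel M N"
    using complex_vector.subspace_0[OF assms(1)] by (auto simp: proj_rel_def)
  then show "closed N"
    using continuous_closed_vimage[OF P, of "\<lambda>x. (x, 0)"] by simp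
qed

theorem corollary3p5:
  fixes M N :: "'a::chilbert_space set"
  assumes "separable_space (euclidean :: 'a topology)"
    and "csubspace M" and "csubspace N"
    and "multivalued_projection (proj_rel M N)"
    and "closed (proj_rel M N)"
  shows "proj_rel M N =
    (graph (\<lambda>x. x - orth_proj N (orth_proj M x)))\<inverse> \<odot>
      rel_restrict (graph (orth_proj (orth_compl N))) {m + n | m n. m \<in> M \<and> n \<in> N}"
proof -
  note M = \<open>csubspace M\<close> closed_range_if_closed_proj_rel[OF assms(2,3,5)]
  note N = \<open>csubspace N\<close> closed_kernel_if_closed_proj_rel[OF assms(2,3,5)]
  let ?A = "\<lambda>x. x - orth_proj N (orth_proj M x)"
  \<comment> \<open>Projecting onto the complement of \<open>N\<close> removes \<open>n\<close> and
    leaves \<open>m - orth_proj N m\<close>; inserting \<open>orth_proj M m = m\<close> gives this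
    the shape of \<open>?A m\<close>.\<close>
  have decomp: "orth_proj (orth_compl N) (m + n) = ?A m" if "m \<in> M" "n \<in> N" for m n
  proof -
    have "orth_proj N m = orth_proj N (m + n) - n"
      using orth_proj_diff[OF N, of "m + n" n] orth_proj_ident[OF N(1) that(2)] by simp
    then show ?thesis
      using that by (simp add: orth_proj_orth_compl[OF N] orth_proj_ident[OF M(1)])
  qed
  have recover: "(m + n, y) \<in> proj_rel M N" if "m \<in> M" "n \<in> N" and eq: "?A m = ?A y" for m n y
  proof -
    \<comment> \<open>Additivity of both projections rewrites \<open>?A m = ?A y\<close> as the
      vanishing of \<open>?A\<close> at \<open>y - m\<close>.\<close>
    have "orth_proj N (orth_proj M (y - m)) = y - m"
      using eq by (simp add: orth_proj_diff[OF M] orth_proj_diff[OF N] algebra_simps)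
    then have d: "y - m \<in> M \<inter> N"
      using M N by (intro orth_proj_comp_fixed_point)
    have "m + (y - m) \<in> M" "n - (y - m) \<in> N"
      using d that M(1) N(1)
      by (blast intro: complex_vector.subspace_add complex_vector.subspace_diff)+
    moreover have "m + n = (m + (y - m)) + (n - (y - m))" "y = m + (y - m)"
      by simp_all
    ultimately show ?thesis
      unfolding proj_rel_def by blast
  qed
  \<comment> \<open>The condition on the right is membership in the product of relations with the
    intermediate point eliminated: that point must equal both
    \<open>orth_proj (orth_compl N) x\<close> and \<open>?A y\<close>, the latter because the graph
    of \<open>?A\<close> is inverted.\<close>
  have "(x, y) \<in> proj_rel M N \<longleftrightarrow>
      (\<exists>m\<in>M. \<exists>n\<in>N. x = m + n \<and> orth_proj (orth_compl N) x = ?A y)" for x y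
  proof
    assume "(x, y) \<in> proj_rel M N"
    then show "\<exists>m\<in>M. \<exists>n\<in>N. x = m + n \<and> orth_proj (orth_compl N) x = ?A y"
      using decomp by (auto simp: proj_rel_def)
  next
    assume "\<exists>m\<in>M. \<exists>n\<in>N. x = m + n \<and> orth_proj (orth_compl N) x = ?A y"
    then obtain m n where mn: "m \<in> M" "n \<in> N" "x = m + n"
      and eq: "orth_proj (orth_compl N) x = ?A y"
      by blast
    have "?A m = ?A y"
      using decomp[OF mn(1,2)] eq mn(3) by simp
    then show "(x, y) \<in> proj_rel M N"
      using recover mn by blast
  qed
  then show ?thesis
    unfolding rel_prod_def rel_restrict_def graph_def
    by (simp add: set_eq_iff relcomp_unfold split_paired_all) blast
qed

end
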